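(* Let $(M,g)$ be a semi-Riemannian manifold with a non-trivial homothety $\phi$, and let $R$ be a fundamental region for the action of $G=\langle\phi\rangle$ (the group generated by $\phi$) on $M$. If $G$ acts cocompactly and $R$ is locally finite, then $\phi$ is inessential, and hence has no fixed points. In particular, if $G$ acts properly discontinuously and $\overline R$ is compact, then $\phi$ is inessential.
   Context: Manifolds are smooth (Hausdorff, second countable). A diffeomorphism $\phi$ of a semi-Riemannian manifold $(M,g)$ is a conformal transformation if $\phi^*g=\mathrm{e}^{2f}g$ for some smooth function $f$ on $M$; it is a homothety if $f$ is constant; it is non-trivial if it is not an isometry of $(M,g)$. A conformal transformation $\phi$ is inessential if there is a metric $\hat g$ conformally equivalent to $g$ (i.e. $\hat g=\mathrm{e}^{2h}g$ for some smooth function $h:M\to\mathbb{R}$) for which $\phi$ is an isometry; otherwise $\phi$ is essential. Let a group $G$ act by homeomorphisms on a topological space $X$. Two sets meet if their intersection is non-empty; $\overline R$ denotes the closure of $R$. The action is cocompact if the orbit space $X/G$, with the quotient topology, is compact. The action is properly discontinuous if any two points $x,y\in X$ have open neighbourhoods $U$ of $x$ and $V$ of $y$ such that $\gamma U$ meets $V$ for only finitely many $\gamma\in G$. An open set $R\subset X$ is a fundamental region for the action if (i) whenever $\gamma R$ meets $R$ for $\gamma\in G$, then $\gamma$ is the identity, and (ii) $\bigcup_{\gamma\in G}\gamma\overline R=X$. A fundamental region $R$ is locally finite if every point of $X$ has an open neighbourhood that meets $\gamma\overline R$ for only finitely many $\gamma\in G$. *)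

theory Defs
  imports
    "HOL-Analysis.Analysis"
    "HOL-Algebra.Bij"
    "HOL-Algebra.Generated_Groups"
begin

section \<open>Smooth manifolds\<close>

text \<open>
  Iterated differentiability, meant for open sets \<open>S\<close>: a map is $C^{k+1}$ if it is differentiable
  and all its directional derivatives are $C^k$.
\<close>

primrec Ck_on :: "nat \<Rightarrow> 'a::euclidean_space set \<Rightarrow> ('a \<Rightarrow> 'b::real_normed_vector) \<Rightarrow> bool" where
  "Ck_on 0 S f \<longleftrightarrow> continuous_on S f"
| "Ck_on (Suc k) S f \<longleftrightarrow>
     (\<forall>x\<in>S. f differentiable (at x)) \<and> (\<forall>v. Ck_on k S (\<lambda>x. frechet_derivative f (at x) v))"

definition smooth_on :: "'a::euclidean_space set \<Rightarrow> ('a \<Rightarrow> 'b::real_normed_vector) \<Rightarrow> bool" where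
  "smooth_on S f \<longleftrightarrow> (\<forall>k. Ck_on k S f)"

text \<open>
  A chart is a pair of its domain and a coordinate map, which is irrelevant outside the domain.
  The underlying space of a manifold is a whole type; Hausdorffness and second countability
  are the type class constraints in \<open>smooth_atlas\<close>. Since \<open>euclidean_space\<close> types are non-trivial,
  zero-dimensional manifolds, all of whose diffeomorphisms are isometries, are left out.
\<close>

type_synonym ('m, 'e) chart = "'m set \<times> ('m \<Rightarrow> 'e)"

definition chart :: "('m::topological_space, 'e::euclidean_space) chart \<Rightarrow> bool" where
  "chart c \<longleftrightarrow> (case c of (U, \<psi>) \<Rightarrow>
     open U \<and> open (\<psi> ` U) \<and> homeomorphism U (\<psi> ` U) \<psi> (inv_into U \<psi>))"

definition smooth_atlas ::
    "('m::{t2_space, second_countable_topology}, 'e::euclidean_space) chart set \<Rightarrow> bool" where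
  "smooth_atlas \<A> \<longleftrightarrow>
     (\<forall>c\<in>\<A>. chart c) \<and> (\<Union>(U, \<psi>)\<in>\<A>. U) = UNIV \<and>
     (\<forall>(U, \<psi>)\<in>\<A>. \<forall>(V, \<eta>)\<in>\<A>. smooth_on (\<psi> ` (U \<inter> V)) (\<eta> \<circ> inv_into U \<psi>))"

definition smooth_fun ::
    "('m::topological_space, 'e::euclidean_space) chart set \<Rightarrow> ('m \<Rightarrow> real) \<Rightarrow> bool" where
  "smooth_fun \<A> f \<longleftrightarrow> (\<forall>(U, \<psi>)\<in>\<A>. smooth_on (\<psi> ` U) (f \<circ> inv_into U \<psi>))"

definition smooth_map ::
    "('m::topological_space, 'e::euclidean_space) chart set \<Rightarrow> ('m \<Rightarrow> 'm) \<Rightarrow> bool" where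
  "smooth_map \<A> \<phi> \<longleftrightarrow> continuous_on UNIV \<phi> \<and>
     (\<forall>(U, \<psi>)\<in>\<A>. \<forall>(V, \<eta>)\<in>\<A>. smooth_on (\<psi> ` (U \<inter> \<phi> -` V)) (\<eta> \<circ> \<phi> \<circ> inv_into U \<psi>))"

definition diffeo ::
    "('m::topological_space, 'e::euclidean_space) chart set \<Rightarrow> ('m \<Rightarrow> 'm) \<Rightarrow> bool" where
  "diffeo \<A> \<phi> \<longleftrightarrow> bij \<phi> \<and> smooth_map \<A> \<phi> \<and> smooth_map \<A> (inv_into UNIV \<phi>)"


section \<open>Tangent vectors and semi-Riemannian metrics\<close>

text \<open>
  Tangent vectors at \<open>p\<close> are the derivations at \<open>p\<close> of the algebra of smooth functions. The last
  clause makes a derivation a unique HOL function, by fixing its value off that algebra.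
\<close>

type_synonym 'm tangent = "('m \<Rightarrow> real) \<Rightarrow> real"

definition tangent_space ::
    "('m::topological_space, 'e::euclidean_space) chart set \<Rightarrow> 'm \<Rightarrow> 'm tangent set" where
  "tangent_space \<A> p = {X.
     (\<forall>f h a b. smooth_fun \<A> f \<longrightarrow> smooth_fun \<A> h \<longrightarrow>
        X (\<lambda>q. a * f q + b * h q) = a * X f + b * X h) \<and>
     (\<forall>f h. smooth_fun \<A> f \<longrightarrow> smooth_fun \<A> h \<longrightarrow>
        X (\<lambda>q. f q * h q) = X f * h p + f p * X h) \<and>
     (\<forall>f. \<not> smooth_fun \<A> f \<longrightarrow> X f = 0)}"

definition push_forward ::
    "('m::topological_space, 'e::euclidean_space) chart set \<Rightarrow> ('m \<Rightarrow> 'm) \<Rightarrow>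
     'm tangent \<Rightarrow> 'm tangent" where
  "push_forward \<A> \<phi> X = (\<lambda>f. if smooth_fun \<A> f then X (f \<circ> \<phi>) else 0)"

definition smooth_vector_field ::
    "('m::topological_space, 'e::euclidean_space) chart set \<Rightarrow> ('m \<Rightarrow> 'm tangent) \<Rightarrow> bool" where
  "smooth_vector_field \<A> X \<longleftrightarrow> (\<forall>p. X p \<in> tangent_space \<A> p) \<and>
     (\<forall>f. smooth_fun \<A> f \<longrightarrow> smooth_fun \<A> (\<lambda>p. X p f))"

text \<open>
  The value of a \<open>(0,2)\<close>-tensor field at \<open>p\<close> only matters on tangent vectors at \<open>p\<close>; equality of
  tensor fields is therefore \<open>tensor_eq\<close>.
\<close>

type_synonym 'm tensor2 = "'m \<Rightarrow> 'm tangent \<Rightarrow> 'm tangent \<Rightarrow> real"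

definition tensor_eq ::
    "('m::topological_space, 'e::euclidean_space) chart set \<Rightarrow> 'm tensor2 \<Rightarrow> 'm tensor2 \<Rightarrow> bool" where
  "tensor_eq \<A> g g' \<longleftrightarrow>
     (\<forall>p. \<forall>X\<in>tangent_space \<A> p. \<forall>Y\<in>tangent_space \<A> p. g p X Y = g' p X Y)"

text \<open>
  Semi-Riemannian metrics are smooth, symmetric, non-degenerate \<open>(0,2)\<close>-tensor fields of arbitrary
  signature. The index is locally constant by non-degeneracy; the definition does not prescribe it
  to agree on different components. A metric conformally equivalent to \<open>g\<close> has the same
  index as \<open>g\<close> at each point.
\<close>

definition semi_riemannian_metric ::
    "('m::topological_space, 'e::euclidean_space) chart set \<Rightarrow> 'm tensor2 \<Rightarrow> bool" where
  "semi_riemannian_metric \<A> g \<longleftrightarrow>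
     (\<forall>p. \<forall>X\<in>tangent_space \<A> p. \<forall>Y\<in>tangent_space \<A> p. \<forall>Z\<in>tangent_space \<A> p. \<forall>a b.
        g p (\<lambda>f. a * X f + b * Y f) Z = a * g p X Z + b * g p Y Z) \<and>
     (\<forall>p. \<forall>X\<in>tangent_space \<A> p. \<forall>Y\<in>tangent_space \<A> p. g p X Y = g p Y X) \<and>
     (\<forall>p. \<forall>X\<in>tangent_space \<A> p. (\<forall>Y\<in>tangent_space \<A> p. g p X Y = 0) \<longrightarrow> X = (\<lambda>f. 0)) \<and>
     (\<forall>X Y. smooth_vector_field \<A> X \<longrightarrow> smooth_vector_field \<A> Y \<longrightarrow>
        smooth_fun \<A> (\<lambda>p. g p (X p) (Y p)))"

definition pull_back ::
    "('m::topological_space, 'e::euclidean_space) chart set \<Rightarrow> ('m \<Rightarrow> 'm) \<Rightarrow>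
     'm tensor2 \<Rightarrow> 'm tensor2" where
  "pull_back \<A> \<phi> g = (\<lambda>p X Y. g (\<phi> p) (push_forward \<A> \<phi> X) (push_forward \<A> \<phi> Y))"

definition conformal_change :: "('m \<Rightarrow> real) \<Rightarrow> 'm tensor2 \<Rightarrow> 'm tensor2" where
  "conformal_change h g = (\<lambda>p X Y. exp (2 * h p) * g p X Y)"

definition conformally_equivalent ::
    "('m::topological_space, 'e::euclidean_space) chart set \<Rightarrow> 'm tensor2 \<Rightarrow> 'm tensor2 \<Rightarrow> bool" where
  "conformally_equivalent \<A> g g' \<longleftrightarrow>
     (\<exists>h. smooth_fun \<A> h \<and> tensor_eq \<A> g' (conformal_change h g))"

definition isometry ::
    "('m::topological_space, 'e::euclidean_space) chart set \<Rightarrow> 'm tensor2 \<Rightarrow> ('m \<Rightarrow> 'm) \<Rightarrow> bool" where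
  "isometry \<A> g \<phi> \<longleftrightarrow> diffeo \<A> \<phi> \<and> tensor_eq \<A> (pull_back \<A> \<phi> g) g"

definition conformal_with_factor ::
    "('m::topological_space, 'e::euclidean_space) chart set \<Rightarrow> 'm tensor2 \<Rightarrow> ('m \<Rightarrow> real) \<Rightarrow>
     ('m \<Rightarrow> 'm) \<Rightarrow> bool" where
  "conformal_with_factor \<A> g f \<phi> \<longleftrightarrow> diffeo \<A> \<phi> \<and> smooth_fun \<A> f \<and>
     tensor_eq \<A> (pull_back \<A> \<phi> g) (conformal_change f g)"

definition conformal_transformation ::
    "('m::topological_space, 'e::euclidean_space) chart set \<Rightarrow> 'm tensor2 \<Rightarrow> ('m \<Rightarrow> 'm) \<Rightarrow> bool" where
  "conformal_transformation \<A> g \<phi> \<longleftrightarrow> (\<exists>f. conformal_with_factor \<A> g f \<phi>)"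

definition homothety ::
    "('m::topological_space, 'e::euclidean_space) chart set \<Rightarrow> 'm tensor2 \<Rightarrow> ('m \<Rightarrow> 'm) \<Rightarrow> bool" where
  "homothety \<A> g \<phi> \<longleftrightarrow> (\<exists>f. conformal_with_factor \<A> g f \<phi> \<and> f constant_on UNIV)"

definition inessential ::
    "('m::topological_space, 'e::euclidean_space) chart set \<Rightarrow> 'm tensor2 \<Rightarrow> ('m \<Rightarrow> 'm) \<Rightarrow> bool" where
  "inessential \<A> g \<phi> \<longleftrightarrow> conformal_transformation \<A> g \<phi> \<and>
     (\<exists>g'. semi_riemannian_metric \<A> g' \<and> conformally_equivalent \<A> g g' \<and> isometry \<A> g' \<phi>)"


section \<open>Group actions\<close>

text \<open>A group acting effectively by homeomorphisms is given as a set \<open>G\<close> of bijections of the space.\<close>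

definition generated_transformations :: "('m \<Rightarrow> 'm) set \<Rightarrow> ('m \<Rightarrow> 'm) set" where
  "generated_transformations S = generate (BijGroup UNIV) S"

definition orbit_of :: "('m \<Rightarrow> 'm) set \<Rightarrow> 'm \<Rightarrow> 'm set" where
  "orbit_of G x = {\<gamma> x | \<gamma>. \<gamma> \<in> G}"

definition orbit_space :: "('m::topological_space \<Rightarrow> 'm) set \<Rightarrow> 'm set topology" where
  "orbit_space G = topology (\<lambda>W. W \<subseteq> range (orbit_of G) \<and> open (orbit_of G -` W))"

lemma openin_orbit_space:
  "openin (orbit_space G) W \<longleftrightarrow> W \<subseteq> range (orbit_of G) \<and> open (orbit_of G -` W)"
proof -
  have "istopology (\<lambda>W. W \<subseteq> range (orbit_of G) \<and> open (orbit_of G -` W))"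
    unfolding istopology_def vimage_Int vimage_Union by (blast intro: open_Int open_UN)
  then show ?thesis
    by (simp add: orbit_space_def)
qed

lemma topspace_orbit_space: "topspace (orbit_space G) = range (orbit_of G)"
proof
  show "topspace (orbit_space G) \<subseteq> range (orbit_of G)"
    using openin_topspace[of "orbit_space G"] unfolding openin_orbit_space by blast
  have "orbit_of G -` range (orbit_of G) = UNIV"
    by blast
  then have "openin (orbit_space G) (range (orbit_of G))"
    unfolding openin_orbit_space by simp
  then show "range (orbit_of G) \<subseteq> topspace (orbit_space G)"
    by (rule openin_subset)
qed

lemma quotient_map_orbit_space: "quotient_map euclidean (orbit_space G) (orbit_of G)"
  unfolding quotient_map_def topspace_orbit_space openin_orbit_space
  by (simp add: vimage_def)

definition cocompact :: "('m::topological_space \<Rightarrow> 'm) set \<Rightarrow> bool" where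
  "cocompact G \<longleftrightarrow> compact_space (orbit_space G)"

definition properly_discontinuous :: "('m::topological_space \<Rightarrow> 'm) set \<Rightarrow> bool" where
  "properly_discontinuous G \<longleftrightarrow>
     (\<forall>x y. \<exists>U V. open U \<and> x \<in> U \<and> open V \<and> y \<in> V \<and> finite {\<gamma> \<in> G. \<gamma> ` U \<inter> V \<noteq> {}})"

definition fundamental_region :: "('m::topological_space \<Rightarrow> 'm) set \<Rightarrow> 'm set \<Rightarrow> bool" where
  "fundamental_region G R \<longleftrightarrow> open R \<and>
     (\<forall>\<gamma>\<in>G. \<gamma> ` R \<inter> R \<noteq> {} \<longrightarrow> \<gamma> = id) \<and> (\<Union>\<gamma>\<in>G. \<gamma> ` closure R) = UNIV"

definition locally_finite_region :: "('m::topological_space \<Rightarrow> 'm) set \<Rightarrow> 'm set \<Rightarrow> bool" where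
  "locally_finite_region G R \<longleftrightarrow>
     (\<forall>x. \<exists>U. open U \<and> x \<in> U \<and> finite {\<gamma> \<in> G. U \<inter> \<gamma> ` closure R \<noteq> {}})"

end

theory Submission
  imports Defs
begin

text \<open>
  Let \<open>\<phi>\<close> multiply \<open>g\<close> by $e^{2c}$. A metric $e^{2h} g$ is invariant under \<open>\<phi>\<close> exactly when
  $h \<circ> \<phi> = h - c$, so the task is to find a smooth solution \<open>h\<close> of this equation. Here $c \<noteq> 0$, as
  \<open>\<phi>\<close> is not an isometry, and a solution therefore excludes fixed points of \<open>\<phi>\<close>.

  A solution exists as soon as \<open>G\<close> acts properly discontinuously and some compact set \<open>K\<close> meets every
  orbit. Each \<open>\<gamma>\<close> in \<open>G\<close> multiplies \<open>g\<close> by $e^{2\<kappa>(\<gamma>)}$ for a homomorphism \<open>\<kappa>\<close> from \<open>G\<close> to the real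
  numbers. Take a smooth function $b \<ge> 0$ with compact support that is positive on \<open>K\<close>. The sum \<open>u\<close>
  of $e^{\<kappa>(\<gamma>)} (b \<circ> \<gamma>)$ over all \<open>\<gamma>\<close> in \<open>G\<close> is locally finite, smooth and positive, and
  $u \<circ> \<delta> = e^{-\<kappa>(\<delta>)} u$ for all \<open>\<delta>\<close> in \<open>G\<close>; so $h = \log u$ is a solution
  (\<open>equivariant_function\<close>, \<open>homothety_group_equivariant_function\<close>).

  The hypotheses on the region \<open>R\<close> enter as follows. If \<open>R\<close> is locally finite, then the action is
  properly discontinuous (\<open>locally_finite_imp_properly_discontinuous\<close>), and since the manifold is
  locally compact, cocompactness yields \<open>K\<close> (\<open>cocompact_imp_compact_meets_orbits\<close>). If the closure
  of \<open>R\<close> is compact, it serves as \<open>K\<close> itself.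

  What remains is calculus: closure properties of iterated differentiability, and bump functions
  (\<open>bump_function\<close>) built from the function $e^{-1/t}$.
\<close>

section \<open>Iterated differentiability in Euclidean spaces\<close>

lemma Ck_on_mono: "Ck_on k S f \<Longrightarrow> T \<subseteq> S \<Longrightarrow> Ck_on k T f"
  by (induction k arbitrary: f) (auto intro: continuous_on_subset)

lemma Ck_on_cong:
  assumes "open S" "\<And>x. x \<in> S \<Longrightarrow> f x = g x" "Ck_on k S f"
  shows "Ck_on k S g"
  using assms(2,3)
proof (induction k arbitrary: f g)
  case 0
  then show ?case by (auto cong: continuous_on_cong)
next
  case (Suc k)
  have D: "(g has_derivative frechet_derivative f (at x)) (at x)" if "x \<in> S" for x
    using Suc.prems that has_derivative_transform_within_open[OF _ \<open>open S\<close> that, of f _ UNIV g]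
    by (auto simp: frechet_derivative_works)
  then have "frechet_derivative f (at x) = frechet_derivative g (at x)" if "x \<in> S" for x
    using that frechet_derivative_at by blast
  then show ?case
    using D Suc.prems Suc.IH[of "\<lambda>x. frechet_derivative f (at x) v" "\<lambda>x. frechet_derivative g (at x) v" for v]
    by (auto simp: differentiable_def)
qed

lemma Ck_on_local:
  assumes "\<And>x. x \<in> S \<Longrightarrow> \<exists>T. open T \<and> x \<in> T \<and> Ck_on k T f"
  shows "Ck_on k S f"
  using assms
proof (induction k arbitrary: f)
  case 0
  then show ?case
    by (metis Ck_on.simps(1) continuous_at_imp_continuous_on continuous_on_eq_continuous_at)
next
  case (Suc k)
  have "Ck_on k S (\<lambda>x. frechet_derivative f (at x) v)" for v
    using Suc.prems by (intro Suc.IH) (metis Ck_on.simps(2))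
  then show ?case using Suc.prems by auto
qed

lemma Ck_on_SucD: "Ck_on (Suc k) S f \<Longrightarrow> Ck_on k S f"
proof (induction k arbitrary: f)
  case 0
  then show ?case
    by (auto intro!: continuous_at_imp_continuous_on differentiable_imp_continuous_within)
next
  case (Suc k)
  then show ?case by (metis Ck_on.simps(2))
qed

text \<open>
  Any pointwise derivative can be used in place of \<open>frechet_derivative\<close>, which agrees with
  it by uniqueness of derivatives.
\<close>

lemma Ck_on_SucI:
  assumes "open S" "\<And>x. x \<in> S \<Longrightarrow> (f has_derivative f' x) (at x)"
    and "\<And>v. Ck_on k S (\<lambda>x. f' x v)"
  shows "Ck_on (Suc k) S f"
proof -
  have "frechet_derivative f (at x) = f' x" if "x \<in> S" for x
    using assms(2)[OF that] frechet_derivative_at by metis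
  then have "Ck_on k S (\<lambda>x. frechet_derivative f (at x) v)" for v
    using assms(3)[of v] by (intro Ck_on_cong[OF \<open>open S\<close> _ assms(3)[of v]]) simp
  then show ?thesis using assms(2) by (auto simp: differentiable_def)
qed

lemma Ck_on_const: "open S \<Longrightarrow> Ck_on k S (\<lambda>x. c)"
proof (induction k arbitrary: c)
  case (Suc k)
  show ?case by (rule Ck_on_SucI[OF Suc.prems has_derivative_const Suc.IH[OF Suc.prems]])
qed auto

lemma Ck_on_bounded_linear:
  assumes "bounded_linear f" "open S"
  shows "Ck_on k S f"
proof (cases k)
  case 0
  then show ?thesis using assms by (simp add: linear_continuous_on)
next
  case (Suc n)
  show ?thesis
    unfolding Suc using assms
    by (intro Ck_on_SucI[OF \<open>open S\<close> bounded_linear_imp_has_derivative] Ck_on_const)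
qed

lemma Ck_on_derivative:
  assumes "Ck_on (Suc k) S f" "x \<in> S"
  shows "(f has_derivative frechet_derivative f (at x)) (at x)"
  using assms by (auto simp: frechet_derivative_works)

lemma Ck_on_add:
  assumes "open S" "Ck_on k S f" "Ck_on k S g"
  shows "Ck_on k S (\<lambda>x. f x + g x)"
  using assms(2,3)
proof (induction k arbitrary: f g)
  case 0
  then show ?case by (auto intro: continuous_on_add)
next
  case (Suc k)
  show ?case
  proof (rule Ck_on_SucI[OF \<open>open S\<close>])
    show "((\<lambda>x. f x + g x) has_derivative
        (\<lambda>v. frechet_derivative f (at x) v + frechet_derivative g (at x) v)) (at x)" if "x \<in> S" for x
      using Suc.prems that by (intro has_derivative_add Ck_on_derivative)
    show "Ck_on k S (\<lambda>x. frechet_derivative f (at x) v + frechet_derivative g (at x) v)" for v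
      using Suc.prems by (intro Suc.IH) auto
  qed
qed

lemma Ck_on_sum:
  assumes "open S" "\<And>i. i \<in> I \<Longrightarrow> Ck_on k S (f i)"
  shows "Ck_on k S (\<lambda>x. \<Sum>i\<in>I. f i x)"
  using assms(2)
  by (induction I rule: infinite_finite_induct) (auto intro: Ck_on_const Ck_on_add \<open>open S\<close>)

lemma (in bounded_bilinear) Ck_on_prod:
  assumes "open S" "Ck_on k S f" "Ck_on k S g"
  shows "Ck_on k S (\<lambda>x. prod (f x) (g x))"
  using assms(2,3)
proof (induction k arbitrary: f g)
  case 0
  then show ?case by (auto intro: continuous_on)
next
  case (Suc k)
  show ?case
  proof (rule Ck_on_SucI[OF \<open>open S\<close>])
    show "((\<lambda>x. prod (f x) (g x)) has_derivative
        (\<lambda>v. prod (f x) (frechet_derivative g (at x) v) + prod (frechet_derivative f (at x) v) (g x))) (at x)"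
      if "x \<in> S" for x
      using Suc.prems that by (intro FDERIV Ck_on_derivative)
    show "Ck_on k S (\<lambda>x. prod (f x) (frechet_derivative g (at x) v) + prod (frechet_derivative f (at x) v) (g x))"
      for v
      using Suc.prems Ck_on_SucD[OF Suc.prems(1)] Ck_on_SucD[OF Suc.prems(2)]
      by (intro Ck_on_add[OF \<open>open S\<close>] Suc.IH) simp_all
  qed
qed

text \<open>
  The derivative of \<open>f \<circ> g\<close> in a direction \<open>v\<close> involves the derivative of \<open>f\<close> in the direction
  \<open>g' x v\<close>, which varies with \<open>x\<close>. Expanding \<open>g' x v\<close> in the standard basis leaves only derivatives
  of \<open>f\<close> in fixed directions; these are of class $C^k$, so the induction hypothesis applies to them.
\<close>

lemma Ck_on_compose:
  fixes f :: "'b::euclidean_space \<Rightarrow> 'c::real_normed_vector"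
  assumes "open S" "open T" "g ` S \<subseteq> T" "Ck_on k T f" "Ck_on k S g"
  shows "Ck_on k S (f \<circ> g)"
  using assms(4,5)
proof (induction k arbitrary: f)
  case 0
  then show ?case
    using assms(3) by (simp only: Ck_on.simps) (metis continuous_on_compose continuous_on_subset)
next
  case (Suc k)
  let ?f' = "\<lambda>y. frechet_derivative f (at y)" and ?g' = "\<lambda>x. frechet_derivative g (at x)"
  show ?case
  proof (rule Ck_on_SucI[OF \<open>open S\<close>])
    fix x assume x: "x \<in> S"
    have f: "(f has_derivative ?f' (g x)) (at (g x))"
      using Suc.prems x assms(3) by (intro Ck_on_derivative) auto
    have g: "(g has_derivative ?g' x) (at x)"
      using Suc.prems x by (intro Ck_on_derivative)
    have lin: "linear (?f' (g x))" by (rule has_derivative_linear[OF f])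
    have "?f' (g x) (\<Sum>b\<in>Basis. (w \<bullet> b) *\<^sub>R b) = (\<Sum>b\<in>Basis. (w \<bullet> b) *\<^sub>R ?f' (g x) b)" for w
      by (simp only: linear_sum[OF lin] linear_scale[OF lin])
    note lin_expand = this[unfolded euclidean_representation]
    show "(f \<circ> g has_derivative (\<lambda>v. \<Sum>b\<in>Basis. (?g' x v \<bullet> b) *\<^sub>R ?f' (g x) b)) (at x)"
      using diff_chain_at[OF g f] unfolding o_def by (rule has_derivative_eq_rhs) (intro ext lin_expand)
  next
    fix v
    show "Ck_on k S (\<lambda>x. \<Sum>b\<in>Basis. (?g' x v \<bullet> b) *\<^sub>R ?f' (g x) b)"
    proof (intro Ck_on_sum[OF \<open>open S\<close>] bounded_bilinear.Ck_on_prod[OF bounded_bilinear_scaleR \<open>open S\<close>]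
        bounded_bilinear.Ck_on_prod[OF bounded_bilinear_inner \<open>open S\<close>] Ck_on_const[OF \<open>open S\<close>])
      show "Ck_on k S (\<lambda>x. ?g' x v)" using Suc.prems by simp
      show "Ck_on k S (\<lambda>x. ?f' (g x) b)" for b
        using Suc.prems Ck_on_SucD Suc.IH[of "\<lambda>y. ?f' y b"] by (auto simp: o_def)
    qed
  qed
qed

lemma smooth_on_compose:
  fixes f :: "'b::euclidean_space \<Rightarrow> 'c::real_normed_vector"
  assumes "open S" "open T" "g ` S \<subseteq> T" "smooth_on T f" "smooth_on S g"
  shows "smooth_on S (f \<circ> g)"
  using assms(4,5) unfolding smooth_on_def by (blast intro: Ck_on_compose[OF assms(1-3)])

lemma smooth_on_cong:
  assumes "open S" "\<And>x. x \<in> S \<Longrightarrow> f x = g x" "smooth_on S f"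
  shows "smooth_on S g"
  using assms Ck_on_cong[OF assms(1,2)] by (auto simp: smooth_on_def)

lemma smooth_on_local:
  assumes "\<And>x. x \<in> S \<Longrightarrow> \<exists>T. open T \<and> x \<in> T \<and> smooth_on T f"
  shows "smooth_on S f"
  unfolding smooth_on_def
proof
  fix k
  show "Ck_on k S f"
    by (rule Ck_on_local) (use assms in \<open>auto simp: smooth_on_def\<close>)
qed

lemma smooth_on_subset: "smooth_on S f \<Longrightarrow> T \<subseteq> S \<Longrightarrow> smooth_on T f"
  by (auto simp: smooth_on_def intro: Ck_on_mono)

lemma Ck_on_Suc_real:
  fixes f :: "real \<Rightarrow> real"
  assumes "open S" "\<And>x. x \<in> S \<Longrightarrow> (f has_real_derivative f' x) (at x)" "Ck_on k S f'"
  shows "Ck_on (Suc k) S f"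
proof (rule Ck_on_SucI[OF \<open>open S\<close>])
  show "(f has_derivative (\<lambda>v. f' x * v)) (at x)" if "x \<in> S" for x
    using assms(2)[OF that] by (simp add: has_field_derivative_def)
  show "Ck_on k S (\<lambda>x. f' x * v)" for v
    by (intro bounded_bilinear.Ck_on_prod[OF bounded_bilinear_mult] assms Ck_on_const)
qed

lemma smooth_on_exp: "smooth_on UNIV (exp :: real \<Rightarrow> real)"
proof -
  have "Ck_on k UNIV (exp :: real \<Rightarrow> real)" for k
  proof (induction k)
    case (Suc k)
    show ?case by (rule Ck_on_Suc_real[OF open_UNIV DERIV_exp Suc.IH])
  qed (simp add: continuous_on_exp)
  then show ?thesis by (simp add: smooth_on_def)
qed

text \<open>
  The derivative of the logarithm is written as \<open>exp (- ln x)\<close>: it is then as smooth as \<open>ln\<close> itself,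
  so that every order of differentiability gives the next one.
\<close>

lemma smooth_on_ln: "smooth_on {0<..} (ln :: real \<Rightarrow> real)"
proof -
  have "Ck_on k {0<..} (ln :: real \<Rightarrow> real)" for k
  proof (induction k)
    case 0
    show ?case by (auto intro!: continuous_intros)
  next
    case (Suc k)
    have neg: "Ck_on k UNIV (uminus :: real \<Rightarrow> real)"
      by (intro Ck_on_bounded_linear bounded_linear_minus bounded_linear_ident open_UNIV)
    have "Ck_on k {0<..} (exp \<circ> (uminus \<circ> (ln :: real \<Rightarrow> real)))"
      using smooth_on_exp neg Suc.IH
      by (intro Ck_on_compose[where T = UNIV] open_UNIV open_greaterThan) (auto simp: smooth_on_def)
    then show ?case
      by (intro Ck_on_Suc_real[OF open_greaterThan, where f' = "exp \<circ> (uminus \<circ> ln)"])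
        (auto intro!: derivative_eq_intros simp: exp_minus field_simps)
  qed
  then show ?thesis by (simp add: smooth_on_def)
qed

section \<open>A smooth function that vanishes on a half-line\<close>

text \<open>
  The case \<open>k = 0\<close> is the classical smooth non-analytic function $e^{-1/t}$. The powers of \<open>1/t\<close> are
  included because the derivatives of that function are linear combinations of members of this
  family.
\<close>

definition flat_exp :: "nat \<Rightarrow> real \<Rightarrow> real" where
  "flat_exp k t = (if 0 < t then exp (- inverse t) * inverse t ^ k else 0)"

lemma flat_exp_tendsto_0: "(flat_exp k \<longlongrightarrow> 0) (at 0)"
proof -
  have "((\<lambda>t. inverse t ^ k / exp (inverse t)) \<longlongrightarrow> 0) (at_right (0::real))"
    by (rule filterlim_compose[OF tendsto_power_div_exp_0 filterlim_inverse_at_top_right])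
  then have "(flat_exp k \<longlongrightarrow> 0) (at_right 0)"
    by (rule Lim_transform_eventually)
      (auto simp: eventually_at_filter flat_exp_def exp_minus divide_inverse mult.commute)
  moreover have "(flat_exp k \<longlongrightarrow> 0) (at_left 0)"
    by (rule Lim_transform_eventually[OF tendsto_const])
      (auto simp: eventually_at_filter flat_exp_def)
  ultimately show ?thesis by (simp add: filterlim_split_at)
qed

text \<open>
  The only delicate point is \<open>t = 0\<close>: there the difference quotient of \<open>flat_exp k\<close> is
  \<open>flat_exp (Suc k)\<close>, which tends to \<open>0\<close> since the exponential beats every power.
\<close>

lemma flat_exp_derivative:
  "(flat_exp k has_real_derivative flat_exp (k + 2) t - real k * flat_exp (Suc k) t) (at t)"
proof (cases t "0 :: real" rule: linorder_cases)
  case less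
  have "((\<lambda>t. 0) has_real_derivative 0) (at t)" by simp
  then have "(flat_exp k has_real_derivative 0) (at t)"
    by (rule has_field_derivative_transform_within_open[where S = "{..<0}"])
      (use less in \<open>auto simp: flat_exp_def\<close>)
  then show ?thesis using less by (simp add: flat_exp_def)
next
  case equal
  have "((\<lambda>h. (flat_exp k (0 + h) - flat_exp k 0) / h) \<longlongrightarrow> 0) (at 0)"
    by (rule Lim_transform_eventually[OF flat_exp_tendsto_0[of "Suc k"]])
      (auto simp: flat_exp_def eventually_at_filter divide_inverse)
  then show ?thesis using equal by (simp add: DERIV_def flat_exp_def)
next
  case greater
  have "((\<lambda>t. exp (- inverse t) * inverse t ^ k) has_real_derivative
      exp (- inverse t) * inverse t ^ (k + 2) - real k * (exp (- inverse t) * inverse t ^ Suc k)) (at t)"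
  proof (rule derivative_eq_intros)
    show "((\<lambda>t. exp (- inverse t)) has_real_derivative exp (- inverse t) * inverse t ^ 2) (at t)"
      using greater by (auto intro!: derivative_eq_intros simp: power2_eq_square)
    have "((\<lambda>t. inverse t ^ k) has_real_derivative
        real k * (- (inverse t ^ Suc (Suc 0)) * inverse t ^ (k - Suc 0))) (at t)"
      using greater by (intro DERIV_power DERIV_inverse) simp
    also have "real k * (- (inverse t ^ Suc (Suc 0)) * inverse t ^ (k - Suc 0)) = - real k * inverse t ^ Suc k"
      by (cases k) (simp_all add: algebra_simps)
    finally show "((\<lambda>t. inverse t ^ k) has_real_derivative - real k * inverse t ^ Suc k) (at t)" .
  qed (simp add: power2_eq_square algebra_simps)
  then have "(flat_exp k has_real_derivative
      exp (- inverse t) * inverse t ^ (k + 2) - real k * (exp (- inverse t) * inverse t ^ Suc k)) (at t)"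
    by (rule has_field_derivative_transform_within_open[where S = "{0<..}"])
      (use greater in \<open>auto simp: flat_exp_def\<close>)
  then show ?thesis using greater by (simp add: flat_exp_def)
qed

lemma smooth_on_flat_exp: "smooth_on UNIV (flat_exp k)"
proof -
  have "Ck_on n UNIV (flat_exp k)" for n k
  proof (induction n arbitrary: k)
    case 0
    show ?case
      by (auto intro!: continuous_at_imp_continuous_on DERIV_isCont[OF flat_exp_derivative])
  next
    case (Suc n)
    have "Ck_on n UNIV (\<lambda>t. flat_exp (k + 2) t + (- real k) * flat_exp (Suc k) t)"
      by (intro Ck_on_add bounded_bilinear.Ck_on_prod[OF bounded_bilinear_mult] Ck_on_const
          open_UNIV Suc.IH)
    then show ?case
      by (intro Ck_on_Suc_real[OF open_UNIV flat_exp_derivative]) simp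
  qed
  then show ?thesis by (simp add: smooth_on_def)
qed

section \<open>Smooth functions on a manifold\<close>

text \<open>
  Values in an arbitrary normed space and an arbitrary domain \<open>W\<close> are allowed, so that the notion
  covers real functions on the manifold as well as the coordinate expressions \<open>\<eta> \<circ> \<phi>\<close> of a map
  \<open>\<phi>\<close>, which are meaningful only on the preimage of the domain of \<open>\<eta>\<close>.
\<close>

definition smooth_within ::
    "('m::topological_space, 'e::euclidean_space) chart set \<Rightarrow> 'm set \<Rightarrow>
     ('m \<Rightarrow> 'b::real_normed_vector) \<Rightarrow> bool" where
  "smooth_within \<A> W f \<longleftrightarrow> (\<forall>(U, \<psi>)\<in>\<A>. smooth_on (\<psi> ` (U \<inter> W)) (f \<circ> inv_into U \<psi>))"

lemma smooth_fun_iff: "smooth_fun \<A> f \<longleftrightarrow> smooth_within \<A> UNIV f"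
  by (simp add: smooth_fun_def smooth_within_def)

lemma smooth_map_iff:
  "smooth_map \<A> \<phi> \<longleftrightarrow>
     continuous_on UNIV \<phi> \<and> (\<forall>(V, \<eta>)\<in>\<A>. smooth_within \<A> (\<phi> -` V) (\<eta> \<circ> \<phi>))"
  by (fastforce simp: smooth_map_def smooth_within_def)

locale smooth_manifold =
  fixes \<A> :: "('m::{t2_space, second_countable_topology}, 'e::euclidean_space) chart set"
  assumes smooth_atlas: "smooth_atlas \<A>"
begin

lemma chart_exists: obtains U \<psi> where "(U, \<psi>) \<in> \<A>" "p \<in> U"
  using smooth_atlas UNIV_I[of p] unfolding smooth_atlas_def by blast

lemma
  assumes "(U, \<psi>) \<in> \<A>"
  shows chart_domain_open: "open U"
    and chart_homeomorphism: "homeomorphism U (\<psi> ` U) \<psi> (inv_into U \<psi>)"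
    and chart_range_open: "open (\<psi> ` U)"
  using smooth_atlas assms unfolding smooth_atlas_def chart_def by fast+

lemma chart_inverse:
  assumes "(U, \<psi>) \<in> \<A>" "x \<in> U"
  shows "inv_into U \<psi> (\<psi> x) = x"
  using homeomorphism_apply1[OF chart_homeomorphism] assms by blast

lemma chart_image_open:
  assumes "(U, \<psi>) \<in> \<A>" "open W"
  shows "open (\<psi> ` (U \<inter> W))"
  using homeomorphism_imp_open_map[OF chart_homeomorphism[OF assms(1)]]
    openin_open_trans[OF _ chart_range_open[OF assms(1)]] assms(2)
  by (simp add: openin_open_Int)

lemma smooth_within_chart:
  assumes "(U, \<psi>) \<in> \<A>"
  shows "smooth_within \<A> U \<psi>"
  using smooth_atlas assms unfolding smooth_atlas_def smooth_within_def by fast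

lemma smooth_within_subset: "smooth_within \<A> W f \<Longrightarrow> W' \<subseteq> W \<Longrightarrow> smooth_within \<A> W' f"
  unfolding smooth_within_def by (blast intro: smooth_on_subset)

lemma smooth_within_local:
  assumes "\<And>x. x \<in> W \<Longrightarrow>
      \<exists>T f'. open T \<and> x \<in> T \<and> smooth_within \<A> T f' \<and> (\<forall>y\<in>T. f y = f' y)"
  shows "smooth_within \<A> W f"
  unfolding smooth_within_def
proof clarify
  fix U \<psi> assume c: "(U, \<psi>) \<in> \<A>"
  show "smooth_on (\<psi> ` (U \<inter> W)) (f \<circ> inv_into U \<psi>)"
  proof (rule smooth_on_local)
    fix y assume "y \<in> \<psi> ` (U \<inter> W)"
    then obtain x where x: "x \<in> U" "x \<in> W" "y = \<psi> x" by blast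
    then obtain T f' where T: "open T" "x \<in> T" "smooth_within \<A> T f'" "\<And>y. y \<in> T \<Longrightarrow> f y = f' y"
      using assms by meson
    have op: "open (\<psi> ` (U \<inter> T))" by (rule chart_image_open[OF c T(1)])
    have "smooth_on (\<psi> ` (U \<inter> T)) (f \<circ> inv_into U \<psi>)"
      by (rule smooth_on_cong[OF op, of "f' \<circ> inv_into U \<psi>"])
        (use c T chart_inverse[OF c] in \<open>auto simp: smooth_within_def\<close>)
    then show "\<exists>T. open T \<and> y \<in> T \<and> smooth_on T (f \<circ> inv_into U \<psi>)"
      using op x T(2) by blast
  qed
qed

lemma smooth_within_compose:
  fixes F :: "'b::euclidean_space \<Rightarrow> 'c::real_normed_vector"
  assumes "open W" "smooth_within \<A> W f" "open T" "f ` W \<subseteq> T" "smooth_on T F"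
  shows "smooth_within \<A> W (F \<circ> f)"
  unfolding smooth_within_def
proof clarify
  fix U \<psi> assume c: "(U, \<psi>) \<in> \<A>"
  have "smooth_on (\<psi> ` (U \<inter> W)) (F \<circ> (f \<circ> inv_into U \<psi>))"
    by (rule smooth_on_compose[OF chart_image_open[OF c \<open>open W\<close>] \<open>open T\<close>])
      (use assms c chart_inverse[OF c] in \<open>auto simp: smooth_within_def\<close>)
  then show "smooth_on (\<psi> ` (U \<inter> W)) (F \<circ> f \<circ> inv_into U \<psi>)"
    by (simp add: comp_assoc)
qed

text \<open>
  Near a point \<open>x\<close> the composition factors through a chart \<open>\<eta>\<close> around \<open>\<phi> x\<close>, as the coordinate
  expression of \<open>f\<close> after that of \<open>\<phi>\<close>; this reduces the claim to the chain rule in Euclidean space.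
\<close>

lemma smooth_within_compose_map:
  fixes f :: "'m \<Rightarrow> 'b::euclidean_space"
  assumes "smooth_map \<A> \<phi>" "open W" "smooth_within \<A> W f"
  shows "smooth_within \<A> (\<phi> -` W) (f \<circ> \<phi>)"
proof (rule smooth_within_local)
  fix x assume x: "x \<in> \<phi> -` W"
  obtain V \<eta> where V: "(V, \<eta>) \<in> \<A>" "\<phi> x \<in> V" by (rule chart_exists)
  let ?T = "\<phi> -` (V \<inter> W)"
  have T: "open ?T"
    using assms(1,2) chart_domain_open[OF V(1)]
    by (auto simp: smooth_map_def continuous_on_open_vimage)
  have "smooth_within \<A> ?T (\<eta> \<circ> \<phi>)"
    using assms(1) V(1) by (auto simp: smooth_map_iff intro: smooth_within_subset)
  then have "smooth_within \<A> ?T ((f \<circ> inv_into V \<eta>) \<circ> (\<eta> \<circ> \<phi>))"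
    using assms(3) V(1)
    by (intro smooth_within_compose[OF T _ chart_image_open[OF V(1) \<open>open W\<close>]])
      (auto simp: smooth_within_def)
  moreover have "(f \<circ> \<phi>) y = ((f \<circ> inv_into V \<eta>) \<circ> (\<eta> \<circ> \<phi>)) y" if "y \<in> ?T" for y
    using that chart_inverse[OF V(1)] by simp
  ultimately show "\<exists>T f'. open T \<and> x \<in> T \<and> smooth_within \<A> T f' \<and> (\<forall>y\<in>T. (f \<circ> \<phi>) y = f' y)"
    using T V(2) x by blast
qed

lemma smooth_fun_compose_map:
  "smooth_map \<A> \<phi> \<Longrightarrow> smooth_fun \<A> f \<Longrightarrow> smooth_fun \<A> (f \<circ> \<phi>)"
  using smooth_within_compose_map[of \<phi> UNIV f] by (simp add: smooth_fun_iff)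

lemma smooth_map_comp:
  assumes "smooth_map \<A> \<phi>" "smooth_map \<A> \<psi>"
  shows "smooth_map \<A> (\<psi> \<circ> \<phi>)"
  unfolding smooth_map_iff
proof (intro conjI ballI, goal_cases)
  case 1
  show ?case
    using assms unfolding smooth_map_def by (metis continuous_on_compose continuous_on_subset top_greatest)
next
  case (2 c)
  obtain V \<eta> where c: "c = (V, \<eta>)" by fastforce
  have "open (\<psi> -` V)"
    using 2 c assms(2) chart_domain_open by (auto simp: smooth_map_def continuous_on_open_vimage)
  then show ?case
    using smooth_within_compose_map[OF assms(1), of "\<psi> -` V" "\<eta> \<circ> \<psi>"] assms(2) 2 c
    by (auto simp: smooth_map_iff comp_assoc vimage_comp)
qed

lemma diffeo_comp: "diffeo \<A> \<phi> \<Longrightarrow> diffeo \<A> \<psi> \<Longrightarrow> diffeo \<A> (\<psi> \<circ> \<phi>)"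
  using smooth_map_comp by (auto simp: diffeo_def bij_comp o_inv_distrib)

lemma smooth_map_id: "smooth_map \<A> id"
  using smooth_within_chart by (auto simp: smooth_map_iff)

lemma smooth_within_imp_continuous:
  assumes "open W" "smooth_within \<A> W f"
  shows "continuous_on W f"
proof (rule continuous_at_imp_continuous_on, rule ballI)
  fix x assume x: "x \<in> W"
  obtain U \<psi> where c: "(U, \<psi>) \<in> \<A>" "x \<in> U" by (rule chart_exists)
  have "smooth_on (\<psi> ` (U \<inter> W)) (f \<circ> inv_into U \<psi>)"
    using assms(2) c(1) by (auto simp: smooth_within_def)
  then have "continuous_on (\<psi> ` (U \<inter> W)) (f \<circ> inv_into U \<psi>)"
    unfolding smooth_on_def using Ck_on.simps(1) by metis
  moreover have "continuous_on (U \<inter> W) \<psi>"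
    using chart_homeomorphism[OF c(1)] by (auto simp: homeomorphism_def intro: continuous_on_subset)
  ultimately have "continuous_on (U \<inter> W) ((f \<circ> inv_into U \<psi>) \<circ> \<psi>)"
    by (rule continuous_on_compose[rotated])
  then have "continuous_on (U \<inter> W) f"
    by (rule continuous_on_eq) (simp add: chart_inverse[OF c(1)])
  then show "isCont f x"
    using continuous_on_eq_continuous_at[of "U \<inter> W" f] assms(1) chart_domain_open[OF c(1)] c(2) x
    by auto
qed

lemma smooth_within_const: "open W \<Longrightarrow> smooth_within \<A> W (\<lambda>x. c)"
  by (auto simp: smooth_within_def smooth_on_def o_def intro: Ck_on_const chart_image_open)

lemma smooth_within_sum:
  assumes "open W" "\<And>i. i \<in> I \<Longrightarrow> smooth_within \<A> W (f i)"
  shows "smooth_within \<A> W (\<lambda>x. \<Sum>i\<in>I. f i x)"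
  using assms unfolding smooth_within_def smooth_on_def o_def
  by (fast intro: Ck_on_sum chart_image_open)

lemma smooth_within_mult:
  fixes f g :: "'m \<Rightarrow> real"
  assumes "open W" "smooth_within \<A> W f" "smooth_within \<A> W g"
  shows "smooth_within \<A> W (\<lambda>x. f x * g x)"
  using assms unfolding smooth_within_def smooth_on_def o_def
  by (fast intro: bounded_bilinear.Ck_on_prod[OF bounded_bilinear_mult] chart_image_open)

lemma smooth_fun_sum: "(\<And>i. i \<in> I \<Longrightarrow> smooth_fun \<A> (f i)) \<Longrightarrow> smooth_fun \<A> (\<lambda>x. \<Sum>i\<in>I. f i x)"
  by (simp add: smooth_fun_iff smooth_within_sum)

lemma smooth_fun_const: "smooth_fun \<A> (\<lambda>x. c)"
  by (simp add: smooth_fun_iff smooth_within_const)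

lemma smooth_fun_mult: "smooth_fun \<A> f \<Longrightarrow> smooth_fun \<A> h \<Longrightarrow> smooth_fun \<A> (\<lambda>x. f x * h x)"
  by (simp add: smooth_fun_iff smooth_within_mult)

lemma smooth_fun_add: "smooth_fun \<A> f \<Longrightarrow> smooth_fun \<A> h \<Longrightarrow> smooth_fun \<A> (\<lambda>x. f x + h x)"
  using smooth_fun_sum[of UNIV "\<lambda>b. if b then f else h"] by (simp add: UNIV_bool add.commute)

section \<open>Bump functions\<close>

text \<open>
  In a chart, \<open>flat_exp 0\<close> applied to \<open>r\<^sup>2 - |v - \<psi> p|\<^sup>2\<close> is positive exactly on an open ball. The preimage
  \<open>L\<close> of the closed ball is compact, hence closed because the manifold is Hausdorff; extension by
  zero is therefore smooth, as the chart domain and the complement of \<open>L\<close> form an open cover.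
\<close>

lemma bump_function_at:
  obtains b L where "smooth_fun \<A> b" "\<And>x. 0 \<le> b x" "0 < b p" "compact L" "\<And>x. b x \<noteq> 0 \<Longrightarrow> x \<in> L"
proof -
  obtain U \<psi> where c: "(U, \<psi>) \<in> \<A>" "p \<in> U" by (rule chart_exists)
  obtain r where r: "0 < r" "cball (\<psi> p) r \<subseteq> \<psi> ` U"
    using chart_range_open[OF c(1)] c(2) by (meson image_eqI open_contains_cball)
  define L where "L = inv_into U \<psi> ` cball (\<psi> p) r"
  define \<beta> :: "'e \<Rightarrow> real" where "\<beta> v = r\<^sup>2 - (v - \<psi> p) \<bullet> (v - \<psi> p)" for v
  define b where "b x = (if x \<in> U then flat_exp 0 (\<beta> (\<psi> x)) else 0)" for x
  have L: "compact L"
    unfolding L_def using chart_homeomorphism[OF c(1)] r(2)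
    by (intro compact_continuous_image compact_cball) (auto simp: homeomorphism_def intro: continuous_on_subset)
  have supp: "x \<in> L" if "b x \<noteq> 0" for x
  proof -
    have x: "x \<in> U" "0 < \<beta> (\<psi> x)" using that by (auto simp: b_def flat_exp_def split: if_splits)
    from x(2) have "(norm (\<psi> x - \<psi> p))\<^sup>2 \<le> r\<^sup>2"
      by (simp add: \<beta>_def power2_norm_eq_inner)
    then have "norm (\<psi> x - \<psi> p) \<le> r"
      by (rule power2_le_imp_le) (use r(1) in simp)
    then have "dist (\<psi> p) (\<psi> x) \<le> r"
      by (simp add: dist_norm norm_minus_commute)
    then show ?thesis
      unfolding L_def using chart_inverse[OF c(1) x(1)] by (metis imageI mem_cball)
  qed
  have "Ck_on k UNIV (\<lambda>v. v - \<psi> p)" for k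
    using Ck_on_add[OF open_UNIV Ck_on_bounded_linear[OF bounded_linear_ident] Ck_on_const[of _ _ "- \<psi> p"]]
    by simp
  then have "Ck_on k UNIV (\<lambda>v. r\<^sup>2 + (-1) * ((v - \<psi> p) \<bullet> (v - \<psi> p)))" for k
    by (intro Ck_on_add bounded_bilinear.Ck_on_prod[OF bounded_bilinear_mult]
        bounded_bilinear.Ck_on_prod[OF bounded_bilinear_inner] Ck_on_const open_UNIV)
  then have "smooth_on UNIV \<beta>"
    by (simp add: smooth_on_def \<beta>_def[abs_def])
  then have on_chart: "smooth_within \<A> U (flat_exp 0 \<circ> (\<beta> \<circ> \<psi>))"
    by (intro smooth_within_compose[where T = UNIV] chart_domain_open[OF c(1)] smooth_within_chart[OF c(1)]
        smooth_on_flat_exp) auto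
  have off_L: "open (- L)"
    using compact_imp_closed[OF L] by auto
  have "L \<subseteq> U"
    unfolding L_def using r(2) by (auto intro: inv_into_into)
  have "smooth_within \<A> UNIV b"
  proof (rule smooth_within_local)
    fix x
    show "\<exists>T f'. open T \<and> x \<in> T \<and> smooth_within \<A> T f' \<and> (\<forall>y\<in>T. b y = f' y)"
    proof (cases "x \<in> U")
      case True
      have "\<forall>y\<in>U. b y = (flat_exp 0 \<circ> (\<beta> \<circ> \<psi>)) y" by (simp add: b_def)
      then show ?thesis using True on_chart chart_domain_open[OF c(1)] by blast
    next
      case False
      have "\<forall>y\<in>-L. b y = 0" using supp by blast
      then show ?thesis using False \<open>L \<subseteq> U\<close> off_L smooth_within_const[OF off_L] by blast
    qed
  qed
  then have "smooth_fun \<A> b" by (simp add: smooth_fun_iff)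
  moreover have "0 \<le> b x" for x by (simp add: b_def flat_exp_def)
  moreover have "0 < b p" using c(2) r(1) by (simp add: b_def flat_exp_def \<beta>_def)
  ultimately show ?thesis using that L supp by blast
qed

lemma bump_function:
  assumes "compact K"
  obtains b L where "smooth_fun \<A> b" "\<And>x. 0 \<le> b x" "\<And>x. x \<in> K \<Longrightarrow> 0 < b x"
    "compact L" "\<And>x. b x \<noteq> 0 \<Longrightarrow> x \<in> L"
proof -
  have "\<exists>b L. smooth_fun \<A> b \<and> (\<forall>x. 0 \<le> b x) \<and> 0 < b p \<and> compact L \<and> (\<forall>x. b x \<noteq> 0 \<longrightarrow> x \<in> L)" for p
    using bump_function_at[of p] by metis
  then obtain b L where bL: "\<And>p. smooth_fun \<A> (b p)" "\<And>p x. 0 \<le> b p x" "\<And>p. 0 < b p p"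
      "\<And>p. compact (L p)" "\<And>p x. b p x \<noteq> 0 \<Longrightarrow> x \<in> L p"
    by metis
  have "open {x. 0 < b p x}" for p
    using smooth_within_imp_continuous[of UNIV "b p"] bL(1)[of p]
    by (auto intro: open_Collect_less simp: smooth_fun_iff)
  then obtain D where D: "finite D" "K \<subseteq> (\<Union>p\<in>D. {x. 0 < b p x})"
    using compactE_image[OF assms, of UNIV "\<lambda>p. {x. 0 < b p x}"] bL(3) by (metis (no_types, lifting) UN_I UNIV_I mem_Collect_eq subsetI)
  let ?b = "\<lambda>x. \<Sum>p\<in>D. b p x"
  show ?thesis
  proof (rule that[of ?b "\<Union>p\<in>D. L p"])
    show "smooth_fun \<A> ?b"
      using bL(1) by (simp add: smooth_fun_iff smooth_within_sum)
    show "0 \<le> ?b x" for x by (simp add: sum_nonneg bL(2))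
    show "0 < ?b x" if xK: "x \<in> K" for x
    proof -
      obtain p where "p \<in> D" "0 < b p x" using xK D(2) by blast
      then show ?thesis using D(1) bL(2) by (intro sum_pos2) auto
    qed
    show "compact (\<Union>p\<in>D. L p)" using D(1) bL(4) by (intro compact_UN) auto
    show "x \<in> (\<Union>p\<in>D. L p)" if "?b x \<noteq> 0" for x
    proof (rule ccontr)
      assume "x \<notin> (\<Union>p\<in>D. L p)"
      then have "?b x = 0" using bL(5) by (intro sum.neutral) blast
      then show False using that by simp
    qed
  qed
qed

end

section \<open>Homotheties and conformal changes\<close>

context smooth_manifold
begin

lemma push_forward_tangent:
  assumes "smooth_map \<A> \<gamma>" "X \<in> tangent_space \<A> p"
  shows "push_forward \<A> \<gamma> X \<in> tangent_space \<A> (\<gamma> p)"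
proof -
  have lin: "X (\<lambda>q. a * f q + b * h q) = a * X f + b * X h"
    and prod: "X (\<lambda>q. f q * h q) = X f * h p + f p * X h"
    if "smooth_fun \<A> f" "smooth_fun \<A> h" for f h a b
    using assms(2) that by (auto simp: tangent_space_def)
  have "smooth_fun \<A> (\<lambda>q. a * f q + b * h q)" if "smooth_fun \<A> f" "smooth_fun \<A> h" for a b f h
    using that by (intro smooth_fun_add smooth_fun_mult smooth_fun_const)
  then show ?thesis
    using smooth_fun_compose_map[OF assms(1)] lin[of "f \<circ> \<gamma>" "h \<circ> \<gamma>" for f h]
      prod[of "f \<circ> \<gamma>" "h \<circ> \<gamma>" for f h]
    by (simp add: tangent_space_def push_forward_def smooth_fun_mult o_def)
qed

lemma push_forward_comp:
  "smooth_map \<A> \<delta> \<Longrightarrow> push_forward \<A> (\<delta> \<circ> \<gamma>) X = push_forward \<A> \<delta> (push_forward \<A> \<gamma> X)"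
  using smooth_fun_compose_map[of \<delta>] by (auto simp: push_forward_def comp_assoc)

lemma push_forward_id: "X \<in> tangent_space \<A> p \<Longrightarrow> push_forward \<A> id X = X"
  by (auto simp: push_forward_def tangent_space_def)

text \<open>
  For a constant factor, conformality is a pointwise identity with \<open>exp (2 * c)\<close> on the right. In this
  form it is visible that the logarithmic factors \<open>c\<close> add up under composition.
\<close>

lemma homothetic_iff:
  "conformal_with_factor \<A> g (\<lambda>_. c) \<gamma> \<longleftrightarrow> diffeo \<A> \<gamma> \<and>
     (\<forall>p. \<forall>X\<in>tangent_space \<A> p. \<forall>Y\<in>tangent_space \<A> p.
        g (\<gamma> p) (push_forward \<A> \<gamma> X) (push_forward \<A> \<gamma> Y) = exp (2 * c) * g p X Y)"
  by (simp add: conformal_with_factor_def tensor_eq_def pull_back_def conformal_change_def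
      smooth_fun_const)

lemma homothetic_id: "conformal_with_factor \<A> g (\<lambda>_. 0) id"
  by (auto simp: homothetic_iff push_forward_id diffeo_def smooth_map_id simp flip: id_def)

lemma homothetic_comp:
  assumes "conformal_with_factor \<A> g (\<lambda>_. c) \<gamma>" "conformal_with_factor \<A> g (\<lambda>_. d) \<delta>"
  shows "conformal_with_factor \<A> g (\<lambda>_. c + d) (\<delta> \<circ> \<gamma>)"
  unfolding homothetic_iff
proof (intro conjI allI ballI)
  show "diffeo \<A> (\<delta> \<circ> \<gamma>)"
    using assms by (auto simp: homothetic_iff intro: diffeo_comp)
  fix p X Y assume XY: "X \<in> tangent_space \<A> p" "Y \<in> tangent_space \<A> p"
  have smooth: "smooth_map \<A> \<gamma>" "smooth_map \<A> \<delta>"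
    using assms by (auto simp: homothetic_iff diffeo_def)
  have "g (\<delta> (\<gamma> p)) (push_forward \<A> \<delta> (push_forward \<A> \<gamma> X)) (push_forward \<A> \<delta> (push_forward \<A> \<gamma> Y))
      = exp (2 * d) * (exp (2 * c) * g p X Y)"
    using assms XY push_forward_tangent[OF smooth(1)] by (simp add: homothetic_iff)
  then show "g ((\<delta> \<circ> \<gamma>) p) (push_forward \<A> (\<delta> \<circ> \<gamma>) X) (push_forward \<A> (\<delta> \<circ> \<gamma>) Y)
      = exp (2 * (c + d)) * g p X Y"
    by (simp add: push_forward_comp[OF smooth(2)] exp_add distrib_left)
qed

lemma homothetic_inv:
  assumes "conformal_with_factor \<A> g (\<lambda>_. c) \<gamma>"
  shows "conformal_with_factor \<A> g (\<lambda>_. - c) (inv_into UNIV \<gamma>)"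
proof -
  let ?i = "inv_into UNIV \<gamma>"
  have \<gamma>: "bij \<gamma>" "smooth_map \<A> \<gamma>" "smooth_map \<A> ?i"
    using assms by (auto simp: homothetic_iff diffeo_def)
  have cancel: "\<gamma> \<circ> ?i = id" using \<gamma>(1) bij_is_surj surj_iff by blast
  have "g (?i p) (push_forward \<A> ?i X) (push_forward \<A> ?i Y) = exp (2 * - c) * g p X Y"
    if X: "X \<in> tangent_space \<A> p" and Y: "Y \<in> tangent_space \<A> p" for p X Y
  proof -
    have "push_forward \<A> \<gamma> (push_forward \<A> ?i Z) = Z" if "Z \<in> tangent_space \<A> p" for Z
      using push_forward_comp[OF \<gamma>(2), of ?i Z] push_forward_id[OF that] by (simp add: cancel)
    moreover have "\<gamma> (?i p) = p" using fun_cong[OF cancel, of p] by simp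
    ultimately have "g p X Y = exp (2 * c) * g (?i p) (push_forward \<A> ?i X) (push_forward \<A> ?i Y)"
      using assms push_forward_tangent[OF \<gamma>(3) X] push_forward_tangent[OF \<gamma>(3) Y] X Y
      unfolding homothetic_iff by metis
    then show ?thesis by (simp add: exp_minus)
  qed
  moreover have "diffeo \<A> ?i"
    using \<gamma> by (auto simp: diffeo_def bij_imp_bij_inv inv_inv_eq)
  ultimately show ?thesis by (simp add: homothetic_iff)
qed

text \<open>
  A tensor field that vanishes identically is multiplied by every number; this is the only
  obstruction to recovering the factor from the map.
\<close>

lemma homothetic_factor_unique:
  assumes "conformal_with_factor \<A> g (\<lambda>_. c) \<gamma>" "conformal_with_factor \<A> g (\<lambda>_. d) \<gamma>"
    and "\<not> tensor_eq \<A> g (\<lambda>p X Y. 0)"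
  shows "c = d"
proof -
  obtain p X Y where "X \<in> tangent_space \<A> p" "Y \<in> tangent_space \<A> p" "g p X Y \<noteq> 0"
    using assms(3) by (auto simp: tensor_eq_def)
  moreover from this have "exp (2 * c) * g p X Y = exp (2 * d) * g p X Y"
    using assms(1,2) by (metis homothetic_iff)
  ultimately show ?thesis by simp
qed

lemma conformal_change_metric:
  assumes "semi_riemannian_metric \<A> g" "smooth_fun \<A> h"
  shows "semi_riemannian_metric \<A> (conformal_change h g)"
proof -
  have "smooth_within \<A> UNIV (exp \<circ> (\<lambda>x. 2 * h x))"
    using smooth_fun_mult[OF smooth_fun_const assms(2)] smooth_on_exp
    by (intro smooth_within_compose[where T = UNIV]) (auto simp: smooth_fun_iff)
  then have "smooth_fun \<A> (\<lambda>x. exp (2 * h x))"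
    by (simp add: smooth_fun_iff o_def)
  then have "smooth_fun \<A> (\<lambda>p. exp (2 * h p) * g p (X p) (Y p))"
    if "smooth_vector_field \<A> X" "smooth_vector_field \<A> Y" for X Y
    using assms(1) that by (intro smooth_fun_mult) (auto simp: semi_riemannian_metric_def)
  then show ?thesis
    using assms(1) by (simp add: semi_riemannian_metric_def conformal_change_def algebra_simps)
qed

text \<open>
  The equation for \<open>h\<close> says that the factor \<open>exp (2 * h)\<close> loses under \<open>\<gamma>\<close> what \<open>g\<close> gains.
\<close>

lemma homothetic_imp_isometry_conformal_change:
  assumes "conformal_with_factor \<A> g (\<lambda>_. c) \<gamma>" "\<And>p. h (\<gamma> p) = h p - c"
  shows "isometry \<A> (conformal_change h g) \<gamma>"
proof -
  have "exp (2 * h (\<gamma> p)) * exp (2 * c) = exp (2 * h p)" for p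
    by (simp add: assms(2) algebra_simps flip: exp_add)
  then have "exp (2 * h (\<gamma> p)) * (exp (2 * c) * r) = exp (2 * h p) * r" for p r
    by (metis mult.assoc)
  then show ?thesis
    using assms(1)
    by (simp add: isometry_def homothetic_iff tensor_eq_def pull_back_def conformal_change_def)
qed

end

section \<open>Group actions\<close>

locale transformation_group =
  fixes G :: "('m::topological_space \<Rightarrow> 'm) set"
  assumes id_mem: "id \<in> G"
    and comp_mem: "\<gamma> \<in> G \<Longrightarrow> \<delta> \<in> G \<Longrightarrow> \<gamma> \<circ> \<delta> \<in> G"
    and inv_mem: "\<gamma> \<in> G \<Longrightarrow> inv_into UNIV \<gamma> \<in> G"
    and bij_mem: "\<gamma> \<in> G \<Longrightarrow> bij \<gamma>"
begin

lemma inv_comp: "\<gamma> \<in> G \<Longrightarrow> inv_into UNIV \<gamma> \<circ> \<gamma> = id" "\<gamma> \<in> G \<Longrightarrow> \<gamma> \<circ> inv_into UNIV \<gamma> = id"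
  using bij_mem by (auto simp: bij_def surj_iff)

text \<open>
  Neighbourhoods \<open>U\<close> and \<open>V\<close> that each meet finitely many translates of the closure of \<open>R\<close> witness
  proper discontinuity: a point of \<open>U\<close> lies in some translate by \<open>\<alpha>\<close>, and if \<open>\<gamma>\<close> moves it into \<open>V\<close>,
  then \<open>V\<close> meets the translate by \<open>\<gamma> \<circ> \<alpha>\<close>. So \<open>\<gamma>\<close> is a quotient of two elements of finite sets.
\<close>

lemma locally_finite_imp_properly_discontinuous:
  assumes "locally_finite_region G R" "(\<Union>\<gamma>\<in>G. \<gamma> ` closure R) = UNIV"
  shows "properly_discontinuous G"
  unfolding properly_discontinuous_def
proof (intro allI)
  fix x y
  obtain U V where U: "open U" "x \<in> U" "finite {\<gamma> \<in> G. U \<inter> \<gamma> ` closure R \<noteq> {}}"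
    and V: "open V" "y \<in> V" "finite {\<gamma> \<in> G. V \<inter> \<gamma> ` closure R \<noteq> {}}"
    using assms(1) unfolding locally_finite_region_def by meson
  let ?A = "{\<gamma> \<in> G. U \<inter> \<gamma> ` closure R \<noteq> {}}" and ?B = "{\<gamma> \<in> G. V \<inter> \<gamma> ` closure R \<noteq> {}}"
  have "{\<gamma> \<in> G. \<gamma> ` U \<inter> V \<noteq> {}} \<subseteq> (\<lambda>(\<beta>, \<alpha>). \<beta> \<circ> inv_into UNIV \<alpha>) ` (?B \<times> ?A)"
  proof
    fix \<gamma> assume "\<gamma> \<in> {\<gamma> \<in> G. \<gamma> ` U \<inter> V \<noteq> {}}"
    then obtain u where \<gamma>: "\<gamma> \<in> G" and u: "u \<in> U" "\<gamma> u \<in> V" by blast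
    obtain \<alpha> r where \<alpha>: "\<alpha> \<in> G" "r \<in> closure R" "u = \<alpha> r"
      using assms(2) by (metis UNIV_I UN_iff imageE)
    have "\<alpha> \<in> ?A" "\<gamma> \<circ> \<alpha> \<in> ?B" using \<alpha> \<gamma> u comp_mem by auto
    moreover have "\<gamma> = (\<gamma> \<circ> \<alpha>) \<circ> inv_into UNIV \<alpha>"
      using inv_comp(2)[OF \<alpha>(1)] by (simp add: comp_assoc)
    ultimately show "\<gamma> \<in> (\<lambda>(\<beta>, \<alpha>). \<beta> \<circ> inv_into UNIV \<alpha>) ` (?B \<times> ?A)"
      by (intro image_eqI[of _ _ "(\<gamma> \<circ> \<alpha>, \<alpha>)"]) auto
  qed
  then have "finite {\<gamma> \<in> G. \<gamma> ` U \<inter> V \<noteq> {}}"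
    using U(3) V(3) by (meson finite_SigmaI finite_imageI finite_subset)
  then show "\<exists>U V. open U \<and> x \<in> U \<and> open V \<and> y \<in> V \<and> finite {\<gamma> \<in> G. \<gamma> ` U \<inter> V \<noteq> {}}"
    using U V by blast
qed

end

lemma properly_discontinuous_near_compact:
  assumes "properly_discontinuous G" "compact L"
  obtains U where "open U" "x \<in> U" "finite {\<gamma> \<in> G. \<gamma> ` U \<inter> L \<noteq> {}}"
proof -
  have "\<forall>y. \<exists>U V. open U \<and> x \<in> U \<and> open V \<and> y \<in> V \<and> finite {\<gamma> \<in> G. \<gamma> ` U \<inter> V \<noteq> {}}"
    using assms(1) unfolding properly_discontinuous_def by (rule spec)
  then obtain U V where "\<forall>y. open (U y) \<and> x \<in> U y \<and> open (V y) \<and> y \<in> V y \<and>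
      finite {\<gamma> \<in> G. \<gamma> ` U y \<inter> V y \<noteq> {}}"
    unfolding choice_iff by (elim exE)
  then have UV: "\<And>y. open (U y)" "\<And>y. x \<in> U y" "\<And>y. open (V y)" "\<And>y. y \<in> V y"
      "\<And>y. finite {\<gamma> \<in> G. \<gamma> ` U y \<inter> V y \<noteq> {}}"
    by simp_all
  obtain D where D: "finite D" "L \<subseteq> (\<Union>y\<in>D. V y)"
    using compactE_image[OF assms(2), of UNIV V] UV(3,4) by (metis UN_I UNIV_I subsetI)
  show ?thesis
  proof (rule that[of "\<Inter>y\<in>D. U y"])
    show "open (\<Inter>y\<in>D. U y)" using D(1) UV(1) by blast
    show "x \<in> (\<Inter>y\<in>D. U y)" using UV(2) by blast
    have "{\<gamma> \<in> G. \<gamma> ` (\<Inter>y\<in>D. U y) \<inter> L \<noteq> {}} \<subseteq> (\<Union>y\<in>D. {\<gamma> \<in> G. \<gamma> ` U y \<inter> V y \<noteq> {}})"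
    proof
      fix \<gamma> assume "\<gamma> \<in> {\<gamma> \<in> G. \<gamma> ` (\<Inter>y\<in>D. U y) \<inter> L \<noteq> {}}"
      then obtain z where z: "\<gamma> \<in> G" "z \<in> (\<Inter>y\<in>D. U y)" "\<gamma> z \<in> L" by blast
      then obtain y where "y \<in> D" "\<gamma> z \<in> V y" using D(2) by blast
      then have "y \<in> D" "\<gamma> z \<in> \<gamma> ` U y \<inter> V y" using z(2) by auto
      then show "\<gamma> \<in> (\<Union>y\<in>D. {\<gamma> \<in> G. \<gamma> ` U y \<inter> V y \<noteq> {}})" using z(1) by auto
    qed
    then show "finite {\<gamma> \<in> G. \<gamma> ` (\<Inter>y\<in>D. U y) \<inter> L \<noteq> {}}"
      by (rule finite_subset) (simp add: D(1) UV(5))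
  qed
qed

text \<open>
  The group operations of \<open>BijGroup UNIV\<close> are composition and inversion of functions up to
  restrictions to \<open>UNIV\<close>; the following facts restate what is needed in terms of plain functions.
\<close>

lemma
  assumes "\<And>\<gamma>. \<gamma> \<in> S \<Longrightarrow> bij \<gamma>"
  shows transformation_group_generated: "transformation_group (generated_transformations S)"
    and generated_transformations_incl: "S \<subseteq> generated_transformations S"
    and generated_transformations_induct:
      "\<lbrakk>\<gamma> \<in> generated_transformations S; P id; \<And>\<gamma>. \<gamma> \<in> S \<Longrightarrow> P \<gamma>;
        \<And>\<gamma>. \<gamma> \<in> S \<Longrightarrow> P (inv_into UNIV \<gamma>); \<And>\<gamma> \<delta>. P \<gamma> \<Longrightarrow> P \<delta> \<Longrightarrow> P (\<gamma> \<circ> \<delta>)\<rbrakk> \<Longrightarrow> P \<gamma>"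
proof -
  let ?B = "BijGroup (UNIV :: 'a set)"
  interpret B: group ?B by (rule group_BijGroup)
  have Bij: "Bij UNIV = {f :: 'a \<Rightarrow> 'a. bij f}" by (auto simp: Bij_def extensional_def)
  have carrier: "carrier ?B = {f. bij f}" by (simp add: BijGroup_def Bij)
  have mult: "\<gamma> \<otimes>\<^bsub>?B\<^esub> \<delta> = \<gamma> \<circ> \<delta>" if "bij \<gamma>" "bij \<delta>" for \<gamma> \<delta>
    using that by (simp add: BijGroup_def Bij compose_def o_def restrict_def)
  have one_eq: "\<one>\<^bsub>?B\<^esub> = id" by (auto simp: BijGroup_def)
  have inv_eq: "inv\<^bsub>?B\<^esub> \<gamma> = inv_into UNIV \<gamma>" if "bij \<gamma>" for \<gamma>
    using that inv_BijGroup[of \<gamma> UNIV] by (simp add: Bij restrict_def)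
  have S: "S \<subseteq> carrier ?B" using assms by (auto simp: carrier)
  have bij: "bij \<gamma>" if "\<gamma> \<in> generated_transformations S" for \<gamma>
    using B.generate_in_carrier[OF S] that by (auto simp: carrier generated_transformations_def)
  show "transformation_group (generated_transformations S)"
  proof
    show "id \<in> generated_transformations S"
      using generate.one[of ?B S] by (simp add: one_eq generated_transformations_def)
    show "bij \<gamma>" if "\<gamma> \<in> generated_transformations S" for \<gamma> using bij that .
    show "\<gamma> \<circ> \<delta> \<in> generated_transformations S"
      if "\<gamma> \<in> generated_transformations S" "\<delta> \<in> generated_transformations S" for \<gamma> \<delta>
      using generate.eng[of \<gamma> ?B S \<delta>] that mult bij by (simp add: generated_transformations_def)
    show "inv_into UNIV \<gamma> \<in> generated_transformations S"
      if "\<gamma> \<in> generated_transformations S" for \<gamma>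
      using B.generate_m_inv_closed[OF S, of \<gamma>] that inv_eq bij by (simp add: generated_transformations_def)
  qed
  show "S \<subseteq> generated_transformations S"
    by (auto simp: generated_transformations_def intro: generate.incl)
  show "P \<gamma>" if "\<gamma> \<in> generated_transformations S" "P id" "\<And>\<gamma>. \<gamma> \<in> S \<Longrightarrow> P \<gamma>"
    "\<And>\<gamma>. \<gamma> \<in> S \<Longrightarrow> P (inv_into UNIV \<gamma>)" "\<And>\<gamma> \<delta>. P \<gamma> \<Longrightarrow> P \<delta> \<Longrightarrow> P (\<gamma> \<circ> \<delta>)"
    using that(1) unfolding generated_transformations_def
  proof (induction rule: generate.induct)
    case one
    show ?case unfolding one_eq by (rule that(2))
  next
    case (incl \<gamma>)
    then show ?case by (rule that(3))
  next
    case (inv \<gamma>)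
    then show ?case unfolding inv_eq[OF assms[OF inv]] by (rule that(4))
  next
    case (eng \<gamma> \<delta>)
    then have "\<gamma> \<otimes>\<^bsub>?B\<^esub> \<delta> = \<gamma> \<circ> \<delta>"
      by (intro mult bij) (simp_all add: generated_transformations_def)
    then show ?case using that(5)[OF eng.IH] by (simp only:)
  qed
qed

section \<open>Equivariant functions\<close>

context smooth_manifold
begin

text \<open>
  Every point has an open neighbourhood \<open>W p\<close> inside a compact set \<open>L p\<close>. The orbit map is open, as the
  saturation of an open set is a union of open preimages, so finitely many of the \<open>W p\<close> cover the
  compact orbit space, and the union of the corresponding \<open>L p\<close> meets every orbit.
\<close>

lemma cocompact_imp_compact_meets_orbits:
  fixes G :: "('m \<Rightarrow> 'm) set"
  assumes "transformation_group G" "\<And>\<gamma>. \<gamma> \<in> G \<Longrightarrow> continuous_on UNIV \<gamma>" "cocompact G"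
  obtains K where "compact K" "\<And>x. \<exists>\<gamma>\<in>G. \<gamma> x \<in> K"
proof -
  interpret transformation_group G by fact
  have "\<exists>W L. open W \<and> p \<in> W \<and> compact L \<and> W \<subseteq> L" for p :: 'm
  proof -
    obtain b L where b: "smooth_fun \<A> b" "0 < b p" "compact L" "\<And>x. b x \<noteq> 0 \<Longrightarrow> x \<in> L"
      using bump_function_at[of p] by metis
    have "open {x. 0 < b x}"
      using smooth_within_imp_continuous[of UNIV b] b(1)
      by (auto intro: open_Collect_less simp: smooth_fun_iff)
    moreover have "{x. 0 < b x} \<subseteq> L" using b(4) by force
    ultimately show ?thesis using b(2,3) by blast
  qed
  then have "\<forall>p :: 'm. \<exists>W L. open W \<and> p \<in> W \<and> compact L \<and> W \<subseteq> L" ..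
  then obtain W L where "\<forall>p :: 'm. open (W p) \<and> p \<in> W p \<and> compact (L p) \<and> W p \<subseteq> L p"
    unfolding choice_iff by (elim exE)
  then have W: "\<And>p. open (W p)" "\<And>p. p \<in> W p" "\<And>p. compact (L p)" "\<And>p. W p \<subseteq> L p"
    by simp_all
  have preimage: "orbit_of G -` (orbit_of G ` A) = (\<Union>\<gamma>\<in>G. \<gamma> -` A)" for A
  proof (intro subset_antisym subsetI)
    fix x assume "x \<in> orbit_of G -` (orbit_of G ` A)"
    then obtain a where eq: "orbit_of G x = orbit_of G a" and a: "a \<in> A" by auto
    have "a \<in> orbit_of G a" using id_mem id_apply[of a] unfolding orbit_of_def by (metis (mono_tags) mem_Collect_eq)
    then obtain \<gamma> where "\<gamma> \<in> G" "a = \<gamma> x"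
      unfolding eq[symmetric] by (auto simp: orbit_of_def)
    then show "x \<in> (\<Union>\<gamma>\<in>G. \<gamma> -` A)" using a by auto
  next
    fix x assume "x \<in> (\<Union>\<gamma>\<in>G. \<gamma> -` A)"
    then obtain \<gamma> where \<gamma>: "\<gamma> \<in> G" and x: "\<gamma> x \<in> A" by auto
    have "\<exists>\<delta>'\<in>G. \<delta> x = \<delta>' (\<gamma> x)" if "\<delta> \<in> G" for \<delta>
      using comp_mem[OF that inv_mem[OF \<gamma>]] fun_cong[OF inv_comp(1)[OF \<gamma>], of x]
      by (intro bexI[of _ "\<delta> \<circ> inv_into UNIV \<gamma>"]) simp_all
    moreover have "\<exists>\<delta>'\<in>G. \<delta> (\<gamma> x) = \<delta>' x" if "\<delta> \<in> G" for \<delta>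
      using comp_mem[OF that \<gamma>] by (intro bexI[of _ "\<delta> \<circ> \<gamma>"]) simp_all
    ultimately have "orbit_of G x = orbit_of G (\<gamma> x)"
      unfolding orbit_of_def by blast
    then show "x \<in> orbit_of G -` (orbit_of G ` A)" using x by auto
  qed
  have "openin (orbit_space G) (orbit_of G ` W p)" for p
    unfolding openin_orbit_space preimage using assms(2) W(1)
    by (auto simp: continuous_on_open_vimage)
  moreover have "topspace (orbit_space G) \<subseteq> (\<Union>p. orbit_of G ` W p)"
    using W(2) by (auto simp: topspace_orbit_space)
  moreover have "compactin (orbit_space G) (topspace (orbit_space G))"
    using assms(3) by (simp add: cocompact_def compact_space_def)
  ultimately have "\<exists>\<F>. finite \<F> \<and> \<F> \<subseteq> range (\<lambda>p. orbit_of G ` W p) \<and>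
      topspace (orbit_space G) \<subseteq> \<Union>\<F>"
    by (intro compactinD) auto
  then obtain \<F> where \<F>: "finite \<F>" "\<F> \<subseteq> range (\<lambda>p. orbit_of G ` W p)"
      "topspace (orbit_space G) \<subseteq> \<Union>\<F>"
    by (elim exE conjE)
  from finite_subset_image[OF \<F>(1,2)]
  obtain D where D: "finite D" "\<F> = (\<lambda>p. orbit_of G ` W p) ` D" by blast
  show ?thesis
  proof (rule that[of "\<Union>p\<in>D. L p"])
    show "compact (\<Union>p\<in>D. L p)" using D(1) W(3) by (intro compact_UN) auto
    fix x
    have "orbit_of G x \<in> \<Union>((\<lambda>p. orbit_of G ` W p) ` D)"
      by (rule subsetD[OF \<F>(3)[unfolded topspace_orbit_space D(2)] rangeI])
    then obtain p where "p \<in> D" "x \<in> orbit_of G -` (orbit_of G ` W p)"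
      by (elim UN_E) (simp only: vimage_eq)
    then show "\<exists>\<gamma>\<in>G. \<gamma> x \<in> (\<Union>p\<in>D. L p)"
      unfolding preimage using W(4) by blast
  qed
qed

text \<open>
  The function is the logarithm of \<open>u x = (\<Sum>\<gamma>\<in>G. exp (\<kappa> \<gamma>) * b (\<gamma> x))\<close>, where \<open>b\<close> is a bump function that is
  positive on \<open>K\<close>. Proper discontinuity makes the sum locally finite, hence smooth; it is positive
  since \<open>K\<close> meets every orbit; and reindexing the sum by \<open>\<gamma> \<mapsto> \<gamma> \<circ> \<delta>\<close> shows that \<open>\<delta>\<close>
  multiplies \<open>u\<close> by \<open>exp (- \<kappa> \<delta>)\<close>.
\<close>

lemma equivariant_function:
  assumes "transformation_group G" "\<And>\<gamma>. \<gamma> \<in> G \<Longrightarrow> smooth_map \<A> \<gamma>"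
    and "properly_discontinuous G" "compact K" "\<And>x. \<exists>\<gamma>\<in>G. \<gamma> x \<in> K"
    and hom: "\<And>\<gamma> \<delta>. \<gamma> \<in> G \<Longrightarrow> \<delta> \<in> G \<Longrightarrow> \<kappa> (\<gamma> \<circ> \<delta>) = \<kappa> \<gamma> + (\<kappa> \<delta> :: real)"
  obtains h where "smooth_fun \<A> h" "\<And>\<delta> x. \<delta> \<in> G \<Longrightarrow> h (\<delta> x) = h x - \<kappa> \<delta>"
proof -
  interpret transformation_group G by fact
  obtain b L where b: "smooth_fun \<A> b" "\<And>x. 0 \<le> b x" "\<And>x. x \<in> K \<Longrightarrow> 0 < b x"
      "compact L" "\<And>x. b x \<noteq> 0 \<Longrightarrow> x \<in> L"
    using bump_function[OF \<open>compact K\<close>] by blast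
  \<comment> \<open>\<open>N x\<close> is finite, so summing over it gives the sum over \<open>G\<close> that is meant; sums over
      infinite sets would be \<open>0\<close> by convention.\<close>
  define N where "N x = {\<gamma> \<in> G. b (\<gamma> x) \<noteq> 0}" for x
  define u where "u x = (\<Sum>\<gamma>\<in>N x. exp (\<kappa> \<gamma>) * b (\<gamma> x))" for x
  have loc: "\<exists>T F. open T \<and> x \<in> T \<and> finite F \<and> F \<subseteq> G \<and> (\<forall>y\<in>T. N y \<subseteq> F)" for x
  proof -
    obtain T where "open T" "x \<in> T" "finite {\<gamma> \<in> G. \<gamma> ` T \<inter> L \<noteq> {}}"
      using properly_discontinuous_near_compact[OF assms(3) b(4)] by blast
    moreover have "N y \<subseteq> {\<gamma> \<in> G. \<gamma> ` T \<inter> L \<noteq> {}}" if "y \<in> T" for y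
      using that b(5) by (auto simp: N_def)
    ultimately show ?thesis by blast
  qed
  then have fin: "finite (N x)" for x by (meson finite_subset)
  have pos: "0 < u x" for x
  proof -
    obtain \<gamma> where "\<gamma> \<in> G" "\<gamma> x \<in> K" using assms(5) by blast
    then have "\<gamma> \<in> N x" "0 < b (\<gamma> x)" using b(3)[of "\<gamma> x"] by (auto simp: N_def)
    then show ?thesis
      unfolding u_def using fin b(2) by (intro sum_pos2[of _ \<gamma>]) auto
  qed
  have smooth: "smooth_fun \<A> u"
    unfolding smooth_fun_iff
  proof (rule smooth_within_local)
    fix x
    obtain T F where T: "open T" "x \<in> T" "finite F" "F \<subseteq> G" "\<And>y. y \<in> T \<Longrightarrow> N y \<subseteq> F"
      using loc by meson
    let ?v = "\<lambda>y. \<Sum>\<gamma>\<in>F. exp (\<kappa> \<gamma>) * (b \<circ> \<gamma>) y"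
    have "smooth_fun \<A> ?v"
      using T(4) by (intro smooth_fun_sum smooth_fun_mult smooth_fun_const
          smooth_fun_compose_map[OF assms(2) b(1)]) auto
    moreover have "u y = ?v y" if "y \<in> T" for y
      unfolding u_def using T(3,4) T(5)[OF that] by (intro sum.mono_neutral_cong_left) (auto simp: N_def)
    ultimately show "\<exists>T f'. open T \<and> x \<in> T \<and> smooth_within \<A> T f' \<and> (\<forall>y\<in>T. u y = f' y)"
      using T(1,2) by (auto simp: smooth_fun_iff intro: smooth_within_subset)
  qed
  have equiv: "u (\<delta> x) = exp (- \<kappa> \<delta>) * u x" if \<delta>: "\<delta> \<in> G" for \<delta> x
  proof -
    have bij: "bij_betw (\<lambda>\<gamma>. \<gamma> \<circ> \<delta>) (N (\<delta> x)) (N x)"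
    proof (rule bij_betw_byWitness[of _ "\<lambda>\<gamma>. \<gamma> \<circ> inv_into UNIV \<delta>"])
      show "(\<lambda>\<gamma>. \<gamma> \<circ> inv_into UNIV \<delta>) ` N x \<subseteq> N (\<delta> x)"
        using \<delta> comp_mem inv_mem[OF \<delta>] fun_cong[OF inv_comp(1)[OF \<delta>], of x]
        by (auto simp: N_def)
    qed (use \<delta> comp_mem inv_comp[OF \<delta>] in \<open>auto simp: N_def comp_assoc\<close>)
    have "exp (- \<kappa> \<delta>) * u x = (\<Sum>\<gamma>\<in>N x. exp (\<kappa> \<gamma> - \<kappa> \<delta>) * b (\<gamma> x))"
      by (simp add: u_def sum_distrib_left exp_diff exp_minus field_simps)
    also have "\<dots> = (\<Sum>\<gamma>\<in>N (\<delta> x). exp (\<kappa> (\<gamma> \<circ> \<delta>) - \<kappa> \<delta>) * b ((\<gamma> \<circ> \<delta>) x))"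
      by (rule sum.reindex_bij_betw[OF bij, symmetric])
    also have "\<dots> = u (\<delta> x)"
      unfolding u_def using hom \<delta> by (intro sum.cong) (auto simp: N_def)
    finally show ?thesis ..
  qed
  show ?thesis
  proof (rule that[of "\<lambda>x. ln (u x)"])
    have "smooth_within \<A> UNIV (ln \<circ> u)"
      using smooth pos smooth_on_ln by (intro smooth_within_compose[where T = "{0<..}"]) (auto simp: smooth_fun_iff)
    then show "smooth_fun \<A> (\<lambda>x. ln (u x))" by (simp add: smooth_fun_iff o_def)
    show "ln (u (\<delta> x)) = ln (u x) - \<kappa> \<delta>" if "\<delta> \<in> G" for \<delta> x
      using equiv[OF that] pos[of x] by (simp add: ln_mult)
  qed
qed

text \<open>
  When \<open>g\<close> is not zero, each element of \<open>G\<close> has a single logarithmic factor, and the factors form a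
  homomorphism from \<open>G\<close> to the real numbers, to which the construction of equivariant functions applies.
\<close>

lemma homothety_group_equivariant_function:
  assumes "transformation_group G" "\<And>\<gamma>. \<gamma> \<in> G \<Longrightarrow> \<exists>c. conformal_with_factor \<A> g (\<lambda>_. c) \<gamma>"
    and "properly_discontinuous G" "compact K" "\<And>x. \<exists>\<gamma>\<in>G. \<gamma> x \<in> K"
    and nonzero: "\<not> tensor_eq \<A> g (\<lambda>p X Y. 0)"
  obtains h where "smooth_fun \<A> h"
    "\<And>\<gamma> c p. \<gamma> \<in> G \<Longrightarrow> conformal_with_factor \<A> g (\<lambda>_. c) \<gamma> \<Longrightarrow> h (\<gamma> p) = h p - c"
proof -
  obtain \<kappa> where \<kappa>: "\<And>\<gamma>. \<gamma> \<in> G \<Longrightarrow> conformal_with_factor \<A> g (\<lambda>_. \<kappa> \<gamma>) \<gamma>"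
    using assms(2) by metis
  have uniq: "\<kappa> \<gamma> = c" if "\<gamma> \<in> G" "conformal_with_factor \<A> g (\<lambda>_. c) \<gamma>" for \<gamma> c
    using homothetic_factor_unique[OF \<kappa>[OF that(1)] that(2) nonzero] .
  have "\<kappa> (\<gamma> \<circ> \<delta>) = \<kappa> \<gamma> + \<kappa> \<delta>" if "\<gamma> \<in> G" "\<delta> \<in> G" for \<gamma> \<delta>
    using uniq[OF transformation_group.comp_mem[OF assms(1) that] homothetic_comp[OF \<kappa>[OF that(2)] \<kappa>[OF that(1)]]]
    by simp
  moreover have "smooth_map \<A> \<gamma>" if "\<gamma> \<in> G" for \<gamma>
    using \<kappa>[OF that] by (auto simp: homothetic_iff diffeo_def)
  ultimately obtain h where "smooth_fun \<A> h" "\<And>\<delta> x. \<delta> \<in> G \<Longrightarrow> h (\<delta> x) = h x - \<kappa> \<delta>"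
    using equivariant_function[OF assms(1) _ assms(3-5), of \<kappa>] by metis
  then show ?thesis using that uniq by metis
qed

end

section \<open>Homotheties that generate a cocompact action\<close>

theorem corollary1p3:
  fixes \<A> :: "('m::{t2_space, second_countable_topology}, 'e::euclidean_space) chart set"
    and g :: "'m tensor2"
    and \<phi> :: "'m \<Rightarrow> 'm"
    and R :: "'m set"
    and G :: "('m \<Rightarrow> 'm) set"
  assumes "smooth_atlas \<A>"
    and "semi_riemannian_metric \<A> g"
    and "homothety \<A> g \<phi>"
    and "\<not> isometry \<A> g \<phi>"
    and "G = generated_transformations {\<phi>}"
    and "fundamental_region G R"
  shows "(cocompact G \<and> locally_finite_region G R \<longrightarrow> inessential \<A> g \<phi> \<and> (\<forall>p. \<phi> p \<noteq> p)) \<and>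
    (properly_discontinuous G \<and> compact (closure R) \<longrightarrow> inessential \<A> g \<phi>)"
proof -
  interpret smooth_manifold \<A> by standard fact
  obtain f c where "conformal_with_factor \<A> g f \<phi>" "\<And>x. f x = c"
    using assms(3) unfolding homothety_def constant_on_def by blast
  then have c: "conformal_with_factor \<A> g (\<lambda>_. c) \<phi>"
    by (simp add: ext[of f "\<lambda>_. c"])
  have \<phi>: "diffeo \<A> \<phi>" "bij \<phi>" using c by (auto simp: homothetic_iff diffeo_def)
  have "c \<noteq> 0"
    using c assms(4) by (auto simp: homothetic_iff isometry_def tensor_eq_def pull_back_def)
  \<comment> \<open>Every diffeomorphism is an isometry of the zero tensor field.\<close>
  have nonzero: "\<not> tensor_eq \<A> g (\<lambda>p X Y. 0)"
  proof
    assume zero: "tensor_eq \<A> g (\<lambda>p X Y. 0)"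
    then have "conformal_with_factor \<A> g (\<lambda>_. 0) \<phi>"
      using c by (simp add: homothetic_iff tensor_eq_def)
    then show False
      using assms(4) by (simp add: homothetic_iff isometry_def tensor_eq_def pull_back_def)
  qed
  have grp: "transformation_group G"
    using transformation_group_generated[of "{\<phi>}"] \<phi> by (simp add: assms(5))
  interpret transformation_group G by (rule grp)
  have \<phi>G: "\<phi> \<in> G" using generated_transformations_incl[of "{\<phi>}"] \<phi> by (simp add: assms(5))
  have hom: "\<exists>c. conformal_with_factor \<A> g (\<lambda>_. c) \<gamma>" if "\<gamma> \<in> G" for \<gamma>
    using that unfolding assms(5)
    by (rule generated_transformations_induct[rotated])
      (use c \<phi> homothetic_id homothetic_comp homothetic_inv in blast)+
  have cover: "(\<Union>\<gamma>\<in>G. \<gamma> ` closure R) = UNIV"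
    using assms(6) by (simp add: fundamental_region_def)
  \<comment> \<open>Both parts of the claim provide a compact set that meets every orbit of a properly
      discontinuous action.\<close>
  have main: "inessential \<A> g \<phi> \<and> (\<forall>p. \<phi> p \<noteq> p)"
    if pd: "properly_discontinuous G" and K: "compact K" "\<And>x. \<exists>\<gamma>\<in>G. \<gamma> x \<in> K" for K
  proof -
    obtain h where h: "smooth_fun \<A> h" "\<And>p. h (\<phi> p) = h p - c"
      using homothety_group_equivariant_function[OF grp hom pd K nonzero] \<phi>G c by metis
    have "isometry \<A> (conformal_change h g) \<phi>"
      using c h(2) by (rule homothetic_imp_isometry_conformal_change)
    moreover have "conformally_equivalent \<A> g (conformal_change h g)"
      using h(1) by (auto simp: conformally_equivalent_def tensor_eq_def)
    ultimately have "inessential \<A> g \<phi>"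
      using conformal_change_metric[OF assms(2) h(1)] c
      by (auto simp: inessential_def conformal_transformation_def)
    moreover have "\<phi> p \<noteq> p" for p using h(2)[of p] \<open>c \<noteq> 0\<close> by auto
    ultimately show ?thesis by blast
  qed
  show ?thesis
  proof (intro conjI impI allI)
    assume A: "cocompact G \<and> locally_finite_region G R"
    have "continuous_on UNIV \<gamma>" if "\<gamma> \<in> G" for \<gamma>
      using hom[OF that] by (auto simp: homothetic_iff diffeo_def smooth_map_def)
    then obtain K where "compact K" "\<And>x. \<exists>\<gamma>\<in>G. \<gamma> x \<in> K"
      using cocompact_imp_compact_meets_orbits[OF grp _ conjunct1[OF A]] by blast
    moreover have "properly_discontinuous G"
      using locally_finite_imp_properly_discontinuous[OF _ cover] A by blast
    ultimately show "inessential \<A> g \<phi>" "\<phi> p \<noteq> p" for p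
      using main by blast+
  next
    assume A: "properly_discontinuous G \<and> compact (closure R)"
    have "\<exists>\<gamma>\<in>G. \<gamma> x \<in> closure R" for x
    proof -
      obtain \<gamma> r where \<gamma>: "\<gamma> \<in> G" "r \<in> closure R" "x = \<gamma> r"
        using cover by (metis UNIV_I UN_iff imageE)
      then show ?thesis
        using inv_mem fun_cong[OF inv_comp(1)[OF \<gamma>(1)], of r]
        by (intro bexI[of _ "inv_into UNIV \<gamma>"]) auto
    qed
    then show "inessential \<A> g \<phi>" using main A by blast
  qed
qed

end
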